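(* Let $d,n\ge 1$, let $F_1,\dots,F_n:\mathbb{R}^d\to\mathbb{R}^d$, and let $F=\frac1n\sum_{i=1}^n F_i$. Let $\ell,\mu>0$ and suppose that each $F_i$ is $\ell$-cocoercive and that $F$ is $\mu$-strongly monotone. Run the SARAH algorithm (defined in the context) from an arbitrary deterministic point $\tilde z^0\in\mathbb{R}^d$ with stepsize $\gamma=\frac{2}{9\ell}$, inner loop length $K=\frac{10\ell}{\mu}$ (assumed to be an integer), and any number $S\ge1$ of outer iterations. Then for every $s\in\{1,\dots,S\}$, $$\mathbb{E}\big[\|F(\tilde z^s)\|^2\big]\le \frac12\,\mathbb{E}\big[\|F(\tilde z^{s-1})\|^2\big].$$
   Context: $\langle\cdot,\cdot\rangle$ is the standard inner product on $\mathbb{R}^d$ and $\|\cdot\|$ the Euclidean norm. Cocoercivity: $F_i$ is $\ell$-cocoercive if $\|F_i(u)-F_i(v)\|^2\le \ell\,\langle F_i(u)-F_i(v),u-v\rangle$ for all $u,v\in\mathbb{R}^d$. Strong monotonicity: $F$ is $\mu$-strongly monotone if $\langle F(u)-F(v),u-v\rangle\ge\mu\|u-v\|^2$ for all $u,v\in\mathbb{R}^d$. SARAH algorithm with stepsize $\gamma>0$, inner loop length $K\ge1$ and number of outer iterations $S\ge1$: start from $\tilde z^0\in\mathbb{R}^d$. For $s=1,\dots,S$: set $z^0=\tilde z^{s-1}$, $v^0=F(z^0)$, $z^1=z^0-\gamma v^0$; for $k=1,\dots,K-1$, sample $i_k$ uniformly from $\{1,\dots,n\}$, independently of all previous random choices,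 and set $v^k=F_{i_k}(z^k)-F_{i_k}(z^{k-1})+v^{k-1}$ and $z^{k+1}=z^k-\gamma v^k$; finally set $\tilde z^s=z^K$. (The variables $z^k,v^k,i_k$ are generated afresh in each outer iteration $s$.) $\mathbb{E}$ denotes expectation over all random choices of the algorithm. *)

theory Defs
  imports "HOL-Probability.Probability"
begin

definition cocoercive :: "real \<Rightarrow> ('a::real_inner \<Rightarrow> 'a) \<Rightarrow> bool" where
  "cocoercive L G \<longleftrightarrow> (\<forall>u v. (norm (G u - G v))\<^sup>2 \<le> L * ((G u - G v) \<bullet> (u - v)))"

definition strongly_monotone :: "real \<Rightarrow> ('a::real_inner \<Rightarrow> 'a) \<Rightarrow> bool" where
  "strongly_monotone \<mu> G \<longleftrightarrow> (\<forall>u v. (G u - G v) \<bullet> (u - v) \<ge> \<mu> * (norm (u - v))\<^sup>2)"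

definition mean_op :: "nat \<Rightarrow> (nat \<Rightarrow> 'a \<Rightarrow> 'a) \<Rightarrow> 'a \<Rightarrow> 'a::real_vector" where
  "mean_op n F z = (1 / real n) *\<^sub>R (\<Sum>i = 1..n. F i z)"

text \<open>
  The iterates are defined for a fixed realisation of the sampled indices; randomness enters
  only when random variables are supplied for the index argument. In the inner loop
  \<open>idx k\<close> is the index sampled at step \<open>k \<ge> 1\<close> and \<open>w\<close> is the starting point \<open>z\<^sup>0\<close>;
  \<open>idx 0\<close> is never used, and \<open>z\<^sup>K\<close> depends only on \<open>idx 1, \<dots>, idx (K - 1)\<close>.
\<close>

fun sarah_z :: "nat \<Rightarrow> (nat \<Rightarrow> 'a \<Rightarrow> 'a) \<Rightarrow> real \<Rightarrow> (nat \<Rightarrow> nat) \<Rightarrow> 'a \<Rightarrow> nat \<Rightarrow> 'a::real_vector"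
  and sarah_v :: "nat \<Rightarrow> (nat \<Rightarrow> 'a \<Rightarrow> 'a) \<Rightarrow> real \<Rightarrow> (nat \<Rightarrow> nat) \<Rightarrow> 'a \<Rightarrow> nat \<Rightarrow> 'a::real_vector"
where
  "sarah_z n F \<gamma> idx w 0 = w"
| "sarah_z n F \<gamma> idx w (Suc k) = sarah_z n F \<gamma> idx w k - \<gamma> *\<^sub>R sarah_v n F \<gamma> idx w k"
| "sarah_v n F \<gamma> idx w 0 = mean_op n F w"
| "sarah_v n F \<gamma> idx w (Suc k) =
     F (idx (Suc k)) (sarah_z n F \<gamma> idx w (Suc k)) - F (idx (Suc k)) (sarah_z n F \<gamma> idx w k)
       + sarah_v n F \<gamma> idx w k"

text \<open>Here \<open>idx s k\<close> is the index sampled at inner step \<open>k\<close> of outer iteration \<open>s \<ge> 1\<close>.\<close>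

primrec sarah_outer ::
  "nat \<Rightarrow> (nat \<Rightarrow> 'a \<Rightarrow> 'a) \<Rightarrow> real \<Rightarrow> nat \<Rightarrow> (nat \<Rightarrow> nat \<Rightarrow> nat) \<Rightarrow> 'a \<Rightarrow> nat \<Rightarrow> 'a::real_vector"
where
  "sarah_outer n F \<gamma> K idx z0 0 = z0"
| "sarah_outer n F \<gamma> K idx z0 (Suc s) =
     sarah_z n F \<gamma> (idx (Suc s)) (sarah_outer n F \<gamma> K idx z0 s) K"

text \<open>
  The indices \<open>i s k\<close>, \<open>1 \<le> s \<le> S\<close>, \<open>1 \<le> k \<le> K - 1\<close>, drawn by a run of the algorithm:
  mutually independent random variables on \<open>M\<close>, each uniform on \<open>{1..n}\<close>.
\<close>

definition sarah_sampling ::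
  "'w measure \<Rightarrow> nat \<Rightarrow> nat \<Rightarrow> nat \<Rightarrow> (nat \<Rightarrow> nat \<Rightarrow> 'w \<Rightarrow> nat) \<Rightarrow> bool"
where
  "sarah_sampling M n K S i \<longleftrightarrow>
     prob_space.indep_vars M (\<lambda>_. count_space UNIV) (\<lambda>(s, k). i s k) ({1..S} \<times> {1..<K}) \<and>
     (\<forall>s\<in>{1..S}. \<forall>k\<in>{1..<K}.
        distr M (count_space UNIV) (i s k) = measure_pmf (pmf_of_set {1..n}))"

end

theory Submission
  imports Defs
begin

text \<open>
  Write \<open>v'\<^sub>j\<close> for the next direction when the index \<open>j\<close> is sampled, \<open>e = F z - v\<close> for the error
  of the estimator, and \<open>c = - \<langle>F z' - F z, v\<rangle> \<ge> \<mu> \<gamma> \<parallel>v\<parallel>\<^sup>2\<close>. As \<open>z' - z = - \<gamma> v\<close>,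
  cocoercivity and \<open>\<gamma> = 2 / (9 L)\<close> give, on average over \<open>j\<close>,
  \<open>\<parallel>v'\<parallel>\<^sup>2 \<le> \<parallel>v\<parallel>\<^sup>2 - (16/9) c\<close> and \<open>\<parallel>e'\<parallel>\<^sup>2 \<le> \<parallel>e\<parallel>\<^sup>2 + (2/9) c\<close>. Hence \<open>\<parallel>v\<parallel>\<^sup>2\<close> contracts by the
  factor \<open>exp (- 32 \<mu> / (81 L))\<close>, and \<open>\<parallel>e\<parallel>\<^sup>2 + \<parallel>v\<parallel>\<^sup>2 / 8\<close> does not increase; initially it equals
  \<open>\<parallel>F w\<parallel>\<^sup>2 / 8\<close>. After \<open>K = 10 L / \<mu>\<close> steps,
  \<open>\<parallel>F z\<parallel>\<^sup>2 \<le> 2 \<parallel>e\<parallel>\<^sup>2 + 2 \<parallel>v\<parallel>\<^sup>2 \<le> (1/4 + 2 exp (- 320/81)) \<parallel>F w\<parallel>\<^sup>2\<close> in expectation;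
  since no index is sampled for step \<open>K\<close>, the mean of \<open>v'\<^sub>j\<close> over \<open>j\<close> plays the role of \<open>v\<close> here.
  Only finitely many equally likely index tables matter, so all expectations become finite sums.
\<close>

section \<open>Expectations as averages over finite index tables\<close>

text \<open>For finite \<open>A\<close>, each table arises as \<open>g(p := j)\<close> from exactly
  \<open>card A\<close> pairs, since the old entry at \<open>p\<close> is overwritten. This replaces
  conditioning on the other indices.\<close>

lemma sum_PiE_resample:
  fixes h :: "('i \<Rightarrow> 'b) \<Rightarrow> real"
  assumes "p \<in> I"
  shows "real (card A) * (\<Sum>g\<in>I \<rightarrow>\<^sub>E A. h g) = (\<Sum>g\<in>I \<rightarrow>\<^sub>E A. \<Sum>j\<in>A. h (g(p := j)))"
proof -
  define J where "J = I - {p}"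
  have I: "I = insert p J" "p \<notin> J"
    using assms by (auto simp: J_def)
  have split: "(\<Sum>g\<in>I \<rightarrow>\<^sub>E A. f g) = (\<Sum>y\<in>A. \<Sum>g\<in>J \<rightarrow>\<^sub>E A. f (g(p := y)))"
    for f :: "('i \<Rightarrow> 'b) \<Rightarrow> real"
    unfolding I(1) PiE_insert_eq
    by (subst sum.reindex[OF inj_combinator[OF I(2)]])
      (simp add: sum.cartesian_product split_def)
  show ?thesis
    unfolding split by (simp add: sum.swap[of _ A "J \<rightarrow>\<^sub>E A"])
qed

text \<open>Almost surely the restricted family is a table with entries in \<open>A\<close>, and
  independence gives every such table the same probability.\<close>

lemma (in prob_space) expectation_uniform_indep:
  fixes X :: "'i \<Rightarrow> 'a \<Rightarrow> 'b::countable" and h :: "('i \<Rightarrow> 'b) \<Rightarrow> real"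
  assumes I: "finite I" and A: "finite A" "A \<noteq> {}"
    and indep: "indep_vars (\<lambda>_. count_space UNIV) X I"
    and unif: "\<And>p. p \<in> I \<Longrightarrow> distr M (count_space UNIV) (X p) = measure_pmf (pmf_of_set A)"
  shows "expectation (\<lambda>\<omega>. h (\<lambda>p\<in>I. X p \<omega>)) = (\<Sum>g\<in>I \<rightarrow>\<^sub>E A. h g) / real (card A) ^ card I"
proof -
  let ?B = "\<lambda>g. {\<omega>\<in>space M. (\<lambda>p\<in>I. X p \<omega>) = g}"
  have X[measurable]: "X p \<in> M \<rightarrow>\<^sub>M count_space UNIV" if "p \<in> I" for p
    using indep that by (auto simp: indep_vars_def)
  have "(\<lambda>\<omega>. \<lambda>p\<in>I. X p \<omega>) \<in> M \<rightarrow>\<^sub>M PiM I (\<lambda>_. count_space UNIV)"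
    by measurable
  then have Y[measurable]: "(\<lambda>\<omega>. \<lambda>p\<in>I. X p \<omega>) \<in> M \<rightarrow>\<^sub>M count_space (I \<rightarrow>\<^sub>E UNIV)"
    by (simp add: count_space_PiM_finite I)
  have prob_X: "prob (X p -` C \<inter> space M) = measure_pmf.prob (pmf_of_set A) C" if "p \<in> I" for p C
    using measure_distr[OF X[OF that], of C] unif[OF that] by simp
  have B[measurable]: "?B g \<in> sets M" if "g \<in> I \<rightarrow>\<^sub>E A" for g
  proof -
    have "?B g = (\<lambda>\<omega>. \<lambda>p\<in>I. X p \<omega>) -` {g} \<inter> space M" by auto
    moreover have "{g} \<in> sets (count_space (I \<rightarrow>\<^sub>E UNIV))" using that by auto
    ultimately show ?thesis using measurable_sets[OF Y] by metis
  qed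
  have prob_B: "prob (?B g) = 1 / real (card A) ^ card I" if g: "g \<in> I \<rightarrow>\<^sub>E A" for g
  \<comment> \<open>An empty intersection would be \<open>UNIV\<close> rather than
    \<open>space M\<close>, so the empty table is treated apart.\<close>
  proof (cases "I = {}")
    case True
    then have "?B g = space M" using g by auto
    then show ?thesis using True by (simp add: prob_space)
  next
    case False
    have "?B g = (\<Inter>p\<in>I. X p -` {g p} \<inter> space M)"
      using False g by (auto simp: fun_eq_iff restrict_def PiE_def extensional_def)
    also have "prob \<dots> = (\<Prod>p\<in>I. prob (X p -` {g p} \<inter> space M))"
      using False I by (intro indep_varsD[OF indep]) auto
    also have "\<dots> = (\<Prod>p\<in>I. 1 / real (card A))"
    proof (rule prod.cong)
      fix p assume "p \<in> I"
      then have "g p \<in> A" using g by auto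
      then show "prob (X p -` {g p} \<inter> space M) = 1 / real (card A)"
        using A by (simp add: prob_X[OF \<open>p \<in> I\<close>] measure_pmf_of_set)
    qed simp
    finally show ?thesis by (simp add: power_one_over)
  qed
  have "AE \<omega> in M. X p \<omega> \<in> A" if "p \<in> I" for p
  proof -
    have "AE x in distr M (count_space UNIV) (X p). x \<in> A"
      unfolding unif[OF that] using A by (simp add: AE_measure_pmf_iff)
    then show ?thesis by (subst (asm) AE_distr_iff) (use X[OF that] in auto)
  qed
  then have AE_A: "AE \<omega> in M. \<forall>p\<in>I. X p \<omega> \<in> A"
    using I by (simp add: AE_finite_allI)
  have fin: "finite (I \<rightarrow>\<^sub>E A)"
    using I A by (simp add: finite_PiE)
  have "expectation (\<lambda>\<omega>. h (\<lambda>p\<in>I. X p \<omega>)) = expectation (\<lambda>\<omega>. \<Sum>g\<in>I \<rightarrow>\<^sub>E A. h g * indicator (?B g) \<omega>)"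
  proof (rule integral_cong_AE)
    show "(\<lambda>\<omega>. h (\<lambda>p\<in>I. X p \<omega>)) \<in> borel_measurable M"
      by (rule measurable_compose[OF Y]) simp
    show "(\<lambda>\<omega>. \<Sum>g\<in>I \<rightarrow>\<^sub>E A. h g * indicator (?B g) \<omega>) \<in> borel_measurable M"
      by (intro borel_measurable_sum borel_measurable_times borel_measurable_const borel_measurable_indicator B)
    show "AE \<omega> in M. h (\<lambda>p\<in>I. X p \<omega>) = (\<Sum>g\<in>I \<rightarrow>\<^sub>E A. h g * indicator (?B g) \<omega>)"
      using AE_A AE_space
    proof eventually_elim
      case (elim \<omega>)
      then have "(\<lambda>p\<in>I. X p \<omega>) \<in> I \<rightarrow>\<^sub>E A" by auto
      moreover have "(\<Sum>g\<in>I \<rightarrow>\<^sub>E A. h g * indicator (?B g) \<omega>)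
          = (\<Sum>g\<in>I \<rightarrow>\<^sub>E A. if g = (\<lambda>p\<in>I. X p \<omega>) then h g else 0)"
        using elim by (intro sum.cong) (auto simp: indicator_def)
      ultimately show ?case using fin by simp
    qed
  qed
  also have "\<dots> = (\<Sum>g\<in>I \<rightarrow>\<^sub>E A. h g * prob (?B g))"
    by (subst Bochner_Integration.integral_sum)
      (auto intro!: sum.cong integrable_mult_right integrable_real_indicator simp: B emeasure_eq_measure)
  also have "\<dots> = (\<Sum>g\<in>I \<rightarrow>\<^sub>E A. h g) / real (card A) ^ card I"
    by (simp add: prob_B sum_divide_distrib)
  finally show ?thesis .
qed

section \<open>Which indices the iterates depend on\<close>

text \<open>Index \<open>k\<close> first enters through the direction \<open>k\<close>, after the
  point \<open>k\<close> is fixed; hence the half-open range for points and the closed one for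
  directions.\<close>

lemma sarah_cong:
  "(\<And>j. j \<in> {1..<k} \<Longrightarrow> idx j = idx' j) \<Longrightarrow> sarah_z n F \<gamma> idx w k = sarah_z n F \<gamma> idx' w k"
  "(\<And>j. j \<in> {1..k} \<Longrightarrow> idx j = idx' j) \<Longrightarrow> sarah_v n F \<gamma> idx w k = sarah_v n F \<gamma> idx' w k"
proof (induction k)
  case 0
  { case 1 then show ?case by simp }
  { case 2 then show ?case by simp }
next
  case (Suc k)
  have zv: "sarah_z n F \<gamma> idx w k = sarah_z n F \<gamma> idx' w k \<and>
      sarah_v n F \<gamma> idx w k = sarah_v n F \<gamma> idx' w k" if "\<And>j. j \<in> {1..k} \<Longrightarrow> idx j = idx' j"
    using Suc.IH that by auto
  { case 1 then show ?case using zv by auto }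
  { case 2 then show ?case using zv by auto }
qed

lemma sarah_outer_cong:
  assumes "\<And>t k. t \<in> {1..s} \<Longrightarrow> k \<in> {1..<K} \<Longrightarrow> idx t k = idx' t k"
  shows "sarah_outer n F \<gamma> K idx z0 s = sarah_outer n F \<gamma> K idx' z0 s"
  using assms
proof (induction s)
  case (Suc s)
  have "sarah_outer n F \<gamma> K idx z0 s = sarah_outer n F \<gamma> K idx' z0 s"
    using Suc by auto
  moreover have "sarah_z n F \<gamma> (idx (Suc s)) w K = sarah_z n F \<gamma> (idx' (Suc s)) w K" for w
    using Suc.prems by (intro sarah_cong) auto
  ultimately show ?case by simp
qed simp

section \<open>One-step estimates\<close>

text \<open>Bias-variance identity: the deviations \<open>m - x j\<close> sum to zero, so the cross
  terms with \<open>e\<close> vanish.\<close>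

lemma sum_norm_sq_mean_diff:
  fixes x :: "'i \<Rightarrow> 'a::real_inner"
  assumes mean: "real (card A) *\<^sub>R m = (\<Sum>j\<in>A. x j)"
  shows "(\<Sum>j\<in>A. (norm (e + m - x j))\<^sup>2) = real (card A) * ((norm e)\<^sup>2 - (norm m)\<^sup>2) + (\<Sum>j\<in>A. (norm (x j))\<^sup>2)"
proof -
  have "(\<Sum>j\<in>A. (norm (e + m - x j))\<^sup>2)
      = (\<Sum>j\<in>A. (norm (e + m))\<^sup>2 - 2 * ((e + m) \<bullet> x j) + (norm (x j))\<^sup>2)"
    by (intro sum.cong) (simp_all add: power2_norm_eq_inner inner_simps inner_commute)
  also have "\<dots> = real (card A) * (norm (e + m))\<^sup>2 - 2 * ((e + m) \<bullet> (\<Sum>j\<in>A. x j)) + (\<Sum>j\<in>A. (norm (x j))\<^sup>2)"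
    by (simp add: sum.distrib sum_subtractf inner_sum_right sum_distrib_left)
  also have "\<dots> = real (card A) * ((norm e)\<^sup>2 - (norm m)\<^sup>2) + (\<Sum>j\<in>A. (norm (x j))\<^sup>2)"
    unfolding mean[symmetric]
    by (simp add: power2_norm_eq_inner inner_simps inner_commute algebra_simps)
  finally show ?thesis .
qed

locale cocoercive_family =
  fixes n :: nat and F :: "nat \<Rightarrow> 'a::real_inner \<Rightarrow> 'a" and L \<mu> :: real
  assumes n_pos: "n \<ge> 1" and L_pos: "L > 0" and \<mu>_pos: "\<mu> > 0"
    and coco: "\<And>j. j \<in> {1..n} \<Longrightarrow> cocoercive L (F j)"
    and mono: "strongly_monotone \<mu> (mean_op n F)"
begin

abbreviation step :: real where "step \<equiv> 2 / (9 * L)"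
text \<open>The product of the factor 16/9 in \<open>sum_norm_direction_le\<close> and the factor
  \<open>2 * \<mu> / (9 * L)\<close> in \<open>mean_incr_inner\<close>.\<close>

abbreviation rate :: real where "rate \<equiv> 32 * \<mu> / (81 * L)"
abbreviation incr :: "nat \<Rightarrow> 'a \<Rightarrow> 'a \<Rightarrow> 'a" where
  "incr j z v \<equiv> F j (z - step *\<^sub>R v) - F j z"
abbreviation mean_incr :: "'a \<Rightarrow> 'a \<Rightarrow> 'a" where
  "mean_incr z v \<equiv> mean_op n F (z - step *\<^sub>R v) - mean_op n F z"

lemma sum_incr: "(\<Sum>j=1..n. incr j z v) = real n *\<^sub>R mean_incr z v"
  using n_pos by (simp add: mean_op_def sum_subtractf scaleR_diff_right)

lemma norm_incr_le:
  assumes "j \<in> {1..n}"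
  shows "(norm (incr j z v))\<^sup>2 \<le> - (2 / 9) * (incr j z v \<bullet> v)"
proof -
  have "(norm (incr j z v))\<^sup>2 \<le> L * (incr j z v \<bullet> ((z - step *\<^sub>R v) - z))"
    using coco[OF assms] unfolding cocoercive_def by blast
  \<comment> \<open>The displacement is \<open>- step *\<^sub>R v\<close>, and
    \<open>L * step = 2 / 9\<close>.\<close>
  also have "\<dots> = - (2 / 9) * (incr j z v \<bullet> v)"
    using L_pos by (simp add: field_simps)
  finally show ?thesis .
qed

lemma mean_incr_inner: "mean_incr z v \<bullet> v \<le> - (2 * \<mu> / (9 * L)) * (norm v)\<^sup>2"
proof -
  have "mean_incr z v \<bullet> ((z - step *\<^sub>R v) - z) \<ge> \<mu> * (norm ((z - step *\<^sub>R v) - z))\<^sup>2"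
    using mono unfolding strongly_monotone_def by blast
  then have "- (step * (mean_incr z v \<bullet> v)) \<ge> \<mu> * (step * norm v)\<^sup>2"
    using L_pos by simp
  then have "step * (- (mean_incr z v \<bullet> v)) \<ge> step * (\<mu> * step * (norm v)\<^sup>2)"
    by (simp add: power2_eq_square algebra_simps)
  moreover have "step > 0" using L_pos by simp
  ultimately have "- (mean_incr z v \<bullet> v) \<ge> \<mu> * step * (norm v)\<^sup>2"
    by (metis mult_le_cancel_left_pos)
  then show ?thesis by (simp add: field_simps)
qed

lemma sum_norm_incr_le: "(\<Sum>j=1..n. (norm (incr j z v))\<^sup>2) \<le> - (2 / 9) * real n * (mean_incr z v \<bullet> v)"
proof -
  have "(\<Sum>j=1..n. (norm (incr j z v))\<^sup>2) \<le> (\<Sum>j=1..n. - (2 / 9) * (incr j z v \<bullet> v))"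
    by (intro sum_mono norm_incr_le)
  also have "\<dots> = - (2 / 9) * ((\<Sum>j=1..n. incr j z v) \<bullet> v)"
    by (simp only: sum_distrib_left inner_sum_left)
  finally show ?thesis unfolding sum_incr by simp
qed

text \<open>The expanded square contains the cross term with factor 2; the squared increments use up
  2/9 of it and leave 16/9.\<close>

lemma sum_norm_direction_le:
  "(\<Sum>j=1..n. (norm (incr j z v + v))\<^sup>2) \<le> real n * ((norm v)\<^sup>2 + (16 / 9) * (mean_incr z v \<bullet> v))"
proof -
  have "(\<Sum>j=1..n. (norm (incr j z v + v))\<^sup>2)
      = (\<Sum>j=1..n. (norm (incr j z v))\<^sup>2 + 2 * (incr j z v \<bullet> v) + (norm v)\<^sup>2)"
    by (intro sum.cong refl) (simp add: power2_norm_eq_inner inner_add inner_commute)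
  also have "\<dots> = (\<Sum>j=1..n. (norm (incr j z v))\<^sup>2) + 2 * ((\<Sum>j=1..n. incr j z v) \<bullet> v) + real n * (norm v)\<^sup>2"
    by (simp only: sum.distrib sum_distrib_left[symmetric] inner_sum_left sum_constant) simp
  finally show ?thesis
    using sum_norm_incr_le[of z v] unfolding sum_incr by (simp add: algebra_simps)
qed

lemma direction_contraction:
  "(\<Sum>j=1..n. (norm (incr j z v + v))\<^sup>2) \<le> real n * (exp (- rate) * (norm v)\<^sup>2)"
proof -
  have "(norm v)\<^sup>2 + (16 / 9) * (mean_incr z v \<bullet> v) \<le> (1 + - rate) * (norm v)\<^sup>2"
    using mean_incr_inner[of z v] by (simp add: algebra_simps)
  also have "\<dots> \<le> exp (- rate) * (norm v)\<^sup>2"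
    by (intro mult_right_mono exp_ge_add_one_self) simp
  finally show ?thesis
    using sum_norm_direction_le[of z v] mult_left_mono[of _ _ "real n"] by fastforce
qed

text \<open>The weight 1/8 balances the possible growth 2/9 of the squared error against the
  guaranteed decrease 16/9 of the squared direction.\<close>

definition lyapunov :: "'a \<Rightarrow> 'a \<Rightarrow> real" where
  "lyapunov z v = (norm (mean_op n F z - v))\<^sup>2 + (norm v)\<^sup>2 / 8"

text \<open>The new error is the old one plus the centred noise
  \<open>mean_incr z v - incr j z v\<close>, so on average its square grows at most by the mean
  squared increment.\<close>

lemma lyapunov_nonincreasing:
  "(\<Sum>j=1..n. lyapunov (z - step *\<^sub>R v) (incr j z v + v)) \<le> real n * lyapunov z v"
proof -
  have "(\<Sum>j=1..n. (norm ((mean_op n F z - v) + mean_incr z v - incr j z v))\<^sup>2)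
      \<le> real n * (norm (mean_op n F z - v))\<^sup>2 + (\<Sum>j=1..n. (norm (incr j z v))\<^sup>2)"
    using sum_norm_sq_mean_diff[where A = "{1..n}" and e = "mean_op n F z - v" and m = "mean_incr z v"
        and x = "\<lambda>j. incr j z v"] sum_incr[of z v]
    by (simp add: right_diff_distrib)
  moreover have "(mean_op n F z - v) + mean_incr z v - incr j z v
      = mean_op n F (z - step *\<^sub>R v) - (incr j z v + v)" for j
    by (simp add: algebra_simps)
  ultimately have "(\<Sum>j=1..n. (norm (mean_op n F (z - step *\<^sub>R v) - (incr j z v + v)))\<^sup>2)
      \<le> real n * (norm (mean_op n F z - v))\<^sup>2 + (\<Sum>j=1..n. (norm (incr j z v))\<^sup>2)"
    by (simp only:)
  then show ?thesis
    using sum_norm_incr_le[of z v] sum_norm_direction_le[of z v]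
    by (simp add: lyapunov_def sum.distrib sum_divide_distrib[symmetric] algebra_simps)
qed

text \<open>The operator at the next point is the old error \<open>?e\<close> plus the mean next
  direction \<open>?u\<close>; the parallelogram law separates the two.\<close>

lemma norm_mean_op_next_le:
  "(norm (mean_op n F (z - step *\<^sub>R v)))\<^sup>2 \<le> 2 * lyapunov z v + 2 * (exp (- rate) * (norm v)\<^sup>2)"
proof -
  let ?e = "mean_op n F z - v" and ?u = "mean_incr z v + v"
  have "real n *\<^sub>R ?u = (\<Sum>j=1..n. incr j z v + v)"
    by (simp only: sum.distrib sum_incr sum_constant_scaleR) (simp add: scaleR_add_right)
  \<comment> \<open>Jensen's inequality for the squared norm, read off from the variance identity
    with \<open>e = 0\<close>.\<close>
  then have "real n * (norm ?u)\<^sup>2 \<le> (\<Sum>j=1..n. (norm (incr j z v + v))\<^sup>2)"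
    using sum_norm_sq_mean_diff[where A = "{1..n}" and e = 0 and m = ?u and x = "\<lambda>j. incr j z v + v"]
      sum_nonneg[of "{1..n}" "\<lambda>j. (norm (0 + ?u - (incr j z v + v)))\<^sup>2"]
    by simp
  then have "real n * (norm ?u)\<^sup>2 \<le> real n * (exp (- rate) * (norm v)\<^sup>2)"
    using direction_contraction[of z v] by linarith
  then have u: "(norm ?u)\<^sup>2 \<le> exp (- rate) * (norm v)\<^sup>2"
    using n_pos by simp
  have "mean_op n F (z - step *\<^sub>R v) = ?e + ?u" by simp
  then have "(norm (mean_op n F (z - step *\<^sub>R v)))\<^sup>2 + (norm (?e - ?u))\<^sup>2 = 2 * (norm ?e)\<^sup>2 + 2 * (norm ?u)\<^sup>2"
    by (simp only: power2_norm_eq_inner inner_add inner_diff inner_commute)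
      (simp add: inner_commute)
  moreover have "(norm ?e)\<^sup>2 \<le> lyapunov z v" by (simp add: lyapunov_def)
  ultimately show ?thesis using u zero_le_power2[of "norm (?e - ?u)"] by linarith
qed

section \<open>The inner loop averaged over all tables\<close>

text \<open>
  The table \<open>g\<close> holds all indices of the run and \<open>p k\<close> is the entry used at inner step \<open>k\<close>;
  the starting point \<open>W g\<close> may depend on the other entries, which carry the earlier outer iterations.
\<close>

context
  fixes p :: "nat \<Rightarrow> 'i" and I :: "'i set" and W :: "('i \<Rightarrow> nat) \<Rightarrow> 'a" and K :: nat
  assumes inj_p: "inj p" and p_in: "\<And>k. k \<in> {1..<K} \<Longrightarrow> p k \<in> I"
    and W_indep: "\<And>g k j. W (g(p k := j)) = W g"
begin

abbreviation "tables \<equiv> I \<rightarrow>\<^sub>E {1..n}"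
abbreviation "iter_z g k \<equiv> sarah_z n F step (\<lambda>j. g (p j)) (W g) k"
abbreviation "iter_v g k \<equiv> sarah_v n F step (\<lambda>j. g (p j)) (W g) k"

text \<open>Overwriting entry \<open>p (Suc k)\<close> does not affect the state at step
  \<open>k\<close>, so the sum over \<open>j\<close> runs over the possible successors of one fixed
  state.\<close>

lemma resample_step:
  assumes "Suc k < K"
  shows "real n * (\<Sum>g\<in>tables. h (iter_z g (Suc k)) (iter_v g (Suc k)))
    = (\<Sum>g\<in>tables. \<Sum>j=1..n. h (iter_z g k - step *\<^sub>R iter_v g k) (incr j (iter_z g k) (iter_v g k) + iter_v g k))"
proof -
  have "iter_z (g(p (Suc k) := j)) k = iter_z g k" "iter_v (g(p (Suc k) := j)) k = iter_v g k" for g j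
    using inj_p by (auto simp: W_indep inj_eq intro!: sarah_cong)
  then show ?thesis
    using sum_PiE_resample[OF p_in, of "Suc k" "{1..n}" "\<lambda>g. h (iter_z g (Suc k)) (iter_v g (Suc k))"] assms
    by (simp add: W_indep)
qed

lemma sum_norm_iter_v_le:
  "k < K \<Longrightarrow> (\<Sum>g\<in>tables. (norm (iter_v g k))\<^sup>2)
    \<le> exp (- rate) ^ k * (\<Sum>g\<in>tables. (norm (mean_op n F (W g)))\<^sup>2)"
proof (induction k)
  case (Suc k)
  have "real n * (\<Sum>g\<in>tables. (norm (iter_v g (Suc k)))\<^sup>2)
      = (\<Sum>g\<in>tables. \<Sum>j=1..n. (norm (incr j (iter_z g k) (iter_v g k) + iter_v g k))\<^sup>2)"
    by (rule resample_step[OF Suc.prems, where h = "\<lambda>_ v. (norm v)\<^sup>2"])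
  also have "\<dots> \<le> (\<Sum>g\<in>tables. real n * (exp (- rate) * (norm (iter_v g k))\<^sup>2))"
    by (intro sum_mono direction_contraction)
  also have "\<dots> = real n * (exp (- rate) * (\<Sum>g\<in>tables. (norm (iter_v g k))\<^sup>2))"
    by (simp only: sum_distrib_left)
  finally have "(\<Sum>g\<in>tables. (norm (iter_v g (Suc k)))\<^sup>2) \<le> exp (- rate) * (\<Sum>g\<in>tables. (norm (iter_v g k))\<^sup>2)"
    using n_pos by simp
  also have "\<dots> \<le> exp (- rate) * (exp (- rate) ^ k * (\<Sum>g\<in>tables. (norm (mean_op n F (W g)))\<^sup>2))"
    using Suc by (intro mult_left_mono) auto
  finally show ?case by (simp add: mult.assoc)
qed simp

lemma sum_lyapunov_le:
  "k < K \<Longrightarrow> (\<Sum>g\<in>tables. lyapunov (iter_z g k) (iter_v g k))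
    \<le> (\<Sum>g\<in>tables. (norm (mean_op n F (W g)))\<^sup>2) / 8"
proof (induction k)
  case 0
  then show ?case by (simp add: lyapunov_def sum_divide_distrib)
next
  case (Suc k)
  have "real n * (\<Sum>g\<in>tables. lyapunov (iter_z g (Suc k)) (iter_v g (Suc k)))
      \<le> (\<Sum>g\<in>tables. real n * lyapunov (iter_z g k) (iter_v g k))"
    unfolding resample_step[OF Suc.prems] by (intro sum_mono lyapunov_nonincreasing)
  then have "(\<Sum>g\<in>tables. lyapunov (iter_z g (Suc k)) (iter_v g (Suc k)))
      \<le> (\<Sum>g\<in>tables. lyapunov (iter_z g k) (iter_v g k))"
    using n_pos by (simp add: sum_distrib_left[symmetric])
  then show ?case using Suc by simp
qed

lemma inner_loop_halves:
  assumes K: "real K = 10 * L / \<mu>"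
  shows "(\<Sum>g\<in>tables. (norm (mean_op n F (iter_z g K)))\<^sup>2)
    \<le> 1 / 2 * (\<Sum>g\<in>tables. (norm (mean_op n F (W g)))\<^sup>2)"
proof -
  let ?N = "\<Sum>g\<in>tables. (norm (mean_op n F (W g)))\<^sup>2"
  have "real K > 0" unfolding K using L_pos \<mu>_pos by simp
  \<comment> \<open>The state at \<open>k = K - 1\<close> is the last one whose direction is
    determined by sampled indices.\<close>
  then obtain k where k: "K = Suc k" by (cases K) auto
  have "exp (- rate) ^ K = exp (- (320 / 81 :: real))"
    using L_pos \<mu>_pos by (simp add: exp_of_nat_mult[symmetric] K)
  also have "\<dots> \<le> 1 / 8"
  proof -
    \<comment> \<open>As 320/81 exceeds 3, the crude bound 2 for \<open>exp 1\<close>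
      suffices.\<close>
    have "(2::real) ^ 3 \<le> exp 1 ^ 3"
      using exp_ge_add_one_self[of 1] by (intro power_mono) auto
    also have "\<dots> = exp (3::real)" by (simp add: exp_of_nat_mult[symmetric])
    also have "\<dots> \<le> exp (320 / 81)" by simp
    finally show ?thesis by (simp add: exp_minus field_simps)
  qed
  finally have small: "exp (- rate) ^ K \<le> 1 / 8" .
  have "(\<Sum>g\<in>tables. (norm (mean_op n F (iter_z g K)))\<^sup>2)
      \<le> (\<Sum>g\<in>tables. 2 * lyapunov (iter_z g k) (iter_v g k) + 2 * (exp (- rate) * (norm (iter_v g k))\<^sup>2))"
    unfolding k sarah_z.simps by (intro sum_mono norm_mean_op_next_le)
  also have "\<dots> = 2 * (\<Sum>g\<in>tables. lyapunov (iter_z g k) (iter_v g k))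
      + 2 * (exp (- rate) * (\<Sum>g\<in>tables. (norm (iter_v g k))\<^sup>2))"
    by (simp only: sum.distrib sum_distrib_left)
  also have "\<dots> \<le> 2 * (?N / 8) + 2 * (exp (- rate) * (exp (- rate) ^ k * ?N))"
    using sum_lyapunov_le[of k] sum_norm_iter_v_le[of k] k
    by (intro add_mono mult_left_mono) auto
  also have "\<dots> = ?N / 4 + 2 * (exp (- rate) ^ K * ?N)"
    by (simp add: k mult.assoc)
  \<comment> \<open>The error and the direction each contribute a quarter of
    \<open>?N\<close>.\<close>
  also have "\<dots> \<le> ?N / 4 + 2 * (1 / 8 * ?N)"
    by (intro add_left_mono mult_left_mono mult_right_mono small sum_nonneg) auto
  finally show ?thesis by simp
qed

end

end

section \<open>From expectations to table sums\<close>

theorem theorem1: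
  fixes F :: "nat \<Rightarrow> real ^ 'd \<Rightarrow> real ^ 'd"
    and n K S s :: nat
    and L \<mu> \<gamma> :: real
    and z0 :: "real ^ 'd"
    and M :: "'w measure"
    and i :: "nat \<Rightarrow> nat \<Rightarrow> 'w \<Rightarrow> nat"
  assumes "n \<ge> 1"
    and "L > 0" and "\<mu> > 0"
    and "\<And>j. j \<in> {1..n} \<Longrightarrow> cocoercive L (F j)"
    and "strongly_monotone \<mu> (mean_op n F)"
    and "\<gamma> = 2 / (9 * L)"
    and "real K = 10 * L / \<mu>"
    and "S \<ge> 1"
    and "prob_space M"
    and "sarah_sampling M n K S i"
    and "s \<in> {1..S}"
  shows "(\<integral>\<omega>. (norm (mean_op n F (sarah_outer n F \<gamma> K (\<lambda>t k. i t k \<omega>) z0 s)))\<^sup>2 \<partial>M)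
       \<le> 1 / 2 * (\<integral>\<omega>. (norm (mean_op n F (sarah_outer n F \<gamma> K (\<lambda>t k. i t k \<omega>) z0 (s - 1))))\<^sup>2 \<partial>M)"
proof -
  interpret M: prob_space M by fact
  interpret cocoercive_family n F L \<mu>
    using assms by unfold_locales auto
  define I where "I = {1..S} \<times> {1..<K}"
  define out where "out t g = sarah_outer n F \<gamma> K (curry g) z0 t" for t and g :: "nat \<times> nat \<Rightarrow> nat"
  obtain r where r: "s = Suc r" using \<open>s \<in> {1..S}\<close> by (cases s) auto
  have "M.indep_vars (\<lambda>_. count_space UNIV) (\<lambda>(s, k). i s k) I"
    and "\<And>q. q \<in> I \<Longrightarrow> distr M (count_space UNIV) ((\<lambda>(s, k). i s k) q) = measure_pmf (pmf_of_set {1..n})"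
    using \<open>sarah_sampling M n K S i\<close> by (auto simp: sarah_sampling_def I_def)
  note uniform = M.expectation_uniform_indep[OF _ _ _ this]
  \<comment> \<open>One table set serves every \<open>t \<le> S\<close>, so both expectations carry
    the same normalisation.\<close>
  have expect: "(\<integral>\<omega>. (norm (mean_op n F (sarah_outer n F \<gamma> K (\<lambda>t k. i t k \<omega>) z0 t)))\<^sup>2 \<partial>M)
      = (\<Sum>g\<in>I \<rightarrow>\<^sub>E {1..n}. (norm (mean_op n F (out t g)))\<^sup>2) / real n ^ card I" if "t \<le> S" for t
  proof -
    have "sarah_outer n F \<gamma> K (\<lambda>t k. i t k \<omega>) z0 t = out t (\<lambda>q\<in>I. (\<lambda>(s, k). i s k) q \<omega>)" for \<omega>
      unfolding out_def using that by (intro sarah_outer_cong) (auto simp: I_def)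
    then show ?thesis
      using uniform[of "\<lambda>g. (norm (mean_op n F (out t g)))\<^sup>2"] \<open>n \<ge> 1\<close> by (simp add: I_def)
  qed
  have "(\<Sum>g\<in>I \<rightarrow>\<^sub>E {1..n}. (norm (mean_op n F (sarah_z n F (2 / (9 * L)) (\<lambda>k. g (s, k)) (out r g) K)))\<^sup>2)
      \<le> 1 / 2 * (\<Sum>g\<in>I \<rightarrow>\<^sub>E {1..n}. (norm (mean_op n F (out r g)))\<^sup>2)"
  \<comment> \<open>Here \<open>p\<close> is \<open>Pair s\<close> and \<open>W\<close> is
    \<open>out r\<close>: earlier outer iterations read only rows up to \<open>r\<close>, never row
    \<open>s\<close>.\<close>
  proof (rule inner_loop_halves)
    show "inj (Pair s)" by (simp add: inj_def)
    show "(s, k) \<in> I" if "k \<in> {1..<K}" for k using that \<open>s \<in> {1..S}\<close> by (simp add: I_def)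
    show "out r (g((s, k) := j)) = out r g" for g k j
      unfolding out_def by (rule sarah_outer_cong) (auto simp: r)
  qed fact
  moreover have "sarah_z n F (2 / (9 * L)) (\<lambda>k. g (s, k)) (out r g) K = out s g" for g
    by (simp add: out_def r curry_def \<open>\<gamma> = 2 / (9 * L)\<close>)
  ultimately have "(\<Sum>g\<in>I \<rightarrow>\<^sub>E {1..n}. (norm (mean_op n F (out s g)))\<^sup>2)
      \<le> 1 / 2 * (\<Sum>g\<in>I \<rightarrow>\<^sub>E {1..n}. (norm (mean_op n F (out r g)))\<^sup>2)"
    by simp
  from divide_right_mono[OF this, of "real n ^ card I"] show ?thesis
    using \<open>s \<in> {1..S}\<close> r expect[of s] expect[of "s - 1"] by simp
qed

end
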